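(* Consider Misère Connect $k$ with $k=2$ on a board of finite height $h\ge 1$ and finite width $w\ge 1$. (i) If $h=1$ and $w\in\{1,2,4,6\}$, optimal play leads to a draw. (ii) If $h=1$ and $w\notin\{1,2,4,6\}$, optimal play leads to a P2 win. (iii) If $h>1$ and $w=1$, the game is a draw. (iv) If $h>1$ and $w>1$, optimal play leads to a P2 win.
   Context: Misère Connect $k$ is played on a grid with $w$ columns and $h$ rows. Player 1 (P1, pieces X) and Player 2 (P2, pieces O) alternate turns, P1 first. On each turn the player selects a non-full column and their piece occupies the lowest empty cell of that column; a column is full after $h$ plays. A player connects $k$ when $k$ of their pieces occupy $k$ consecutive cells in a horizontal, vertical, or diagonal (either direction) line; for $k=2$ this means two of their pieces are horizontally, vertically, or diagonally adjacent. The first player to connect $k$ loses (the other wins) and the game ends. If the board fills with no player having connected $k$, the game is a draw. "Optimal play leads to a P2 win" means P2 has a winning strategy; "optimal play leads to a draw" means each player has a strategy guaranteeing that they do not lose. *)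

theory Defs
  imports Main
begin

datatype player = P1 | P2

fun opponent :: "player \<Rightarrow> player" where
  "opponent P1 = P2"
| "opponent P2 = P1"

text \<open>A board maps each column to the stack of pieces in it, listed from the bottom up, so that
  appending to a column places the piece in its lowest empty cell.\<close>

type_synonym board = "nat \<Rightarrow> player list"

definition drop_piece :: "player \<Rightarrow> nat \<Rightarrow> board \<Rightarrow> board" where
  "drop_piece p c b = b(c := b c @ [p])"

fun play_from :: "player \<Rightarrow> nat list \<Rightarrow> board \<Rightarrow> board" where
  "play_from p [] b = b"
| "play_from p (c # ms) b = play_from (opponent p) ms (drop_piece p c b)"

text \<open>A history is the list of the columns chosen so far, oldest first; P1 makes the first move.\<close>

definition board_of :: "nat list \<Rightarrow> board" where
  "board_of ms = play_from P1 ms (\<lambda>c. [])"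

definition to_move :: "nat list \<Rightarrow> player" where
  "to_move ms = (if even (length ms) then P1 else P2)"

text \<open>Coordinates are integers (column, row), since a line may descend.\<close>

definition piece_at :: "board \<Rightarrow> player \<Rightarrow> int \<Rightarrow> int \<Rightarrow> bool" where
  "piece_at b p x y \<longleftrightarrow>
     0 \<le> x \<and> 0 \<le> y \<and> nat y < length (b (nat x)) \<and> b (nat x) ! nat y = p"

definition connects :: "nat \<Rightarrow> board \<Rightarrow> player \<Rightarrow> bool" where
  "connects k b p \<longleftrightarrow>
     (\<exists>x y dx dy. (dx, dy) \<in> {(1, 0), (0, 1), (1, 1), (1, - 1)} \<and>
        (\<forall>i<k. piece_at b p (x + int i * dx) (y + int i * dy)))"

text \<open>In the following, the parameters are the connection length \<open>k\<close>, the number of columns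
  \<open>w\<close> and the number of rows \<open>h\<close>.\<close>

definition full :: "nat \<Rightarrow> nat \<Rightarrow> board \<Rightarrow> bool" where
  "full w h b \<longleftrightarrow> (\<forall>c<w. length (b c) = h)"

definition game_over :: "nat \<Rightarrow> nat \<Rightarrow> nat \<Rightarrow> nat list \<Rightarrow> bool" where
  "game_over k w h ms \<longleftrightarrow> (\<exists>p. connects k (board_of ms) p) \<or> full w h (board_of ms)"

definition legal_move :: "nat \<Rightarrow> nat \<Rightarrow> nat \<Rightarrow> nat list \<Rightarrow> nat \<Rightarrow> bool" where
  "legal_move k w h ms c \<longleftrightarrow>
     \<not> game_over k w h ms \<and> c < w \<and> length (board_of ms c) < h"

definition legal_history :: "nat \<Rightarrow> nat \<Rightarrow> nat \<Rightarrow> nat list \<Rightarrow> bool" where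
  "legal_history k w h ms \<longleftrightarrow> (\<forall>i<length ms. legal_move k w h (take i ms) (ms ! i))"

definition complete_play :: "nat \<Rightarrow> nat \<Rightarrow> nat \<Rightarrow> nat list \<Rightarrow> bool" where
  "complete_play k w h ms \<longleftrightarrow> legal_history k w h ms \<and> game_over k w h ms"

text \<open>The next two notions are meant for complete plays. There at most one player has connected,
  namely the first to do so, because the game ends at that point.\<close>

definition loses :: "nat \<Rightarrow> nat list \<Rightarrow> player \<Rightarrow> bool" where
  "loses k ms p \<longleftrightarrow> connects k (board_of ms) p"

definition drawn :: "nat \<Rightarrow> nat \<Rightarrow> nat \<Rightarrow> nat list \<Rightarrow> bool" where
  "drawn k w h ms \<longleftrightarrow> full w h (board_of ms) \<and> (\<forall>p. \<not> connects k (board_of ms) p)"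

type_synonym strategy = "nat list \<Rightarrow> nat"

definition strategy_for :: "nat \<Rightarrow> nat \<Rightarrow> nat \<Rightarrow> player \<Rightarrow> strategy \<Rightarrow> bool" where
  "strategy_for k w h p s \<longleftrightarrow>
     (\<forall>ms. legal_history k w h ms \<and> \<not> game_over k w h ms \<and> to_move ms = p \<longrightarrow>
        legal_move k w h ms (s ms))"

definition follows :: "player \<Rightarrow> strategy \<Rightarrow> nat list \<Rightarrow> bool" where
  "follows p s ms \<longleftrightarrow>
     (\<forall>i<length ms. to_move (take i ms) = p \<longrightarrow> ms ! i = s (take i ms))"

text \<open>Every play ends after at most \<open>w * h\<close> moves, so it suffices to consider complete plays.\<close>

definition winning_strategy :: "nat \<Rightarrow> nat \<Rightarrow> nat \<Rightarrow> player \<Rightarrow> strategy \<Rightarrow> bool" where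
  "winning_strategy k w h p s \<longleftrightarrow> strategy_for k w h p s \<and>
     (\<forall>ms. complete_play k w h ms \<and> follows p s ms \<longrightarrow> loses k ms (opponent p))"

definition nonlosing_strategy :: "nat \<Rightarrow> nat \<Rightarrow> nat \<Rightarrow> player \<Rightarrow> strategy \<Rightarrow> bool" where
  "nonlosing_strategy k w h p s \<longleftrightarrow> strategy_for k w h p s \<and>
     (\<forall>ms. complete_play k w h ms \<and> follows p s ms \<longrightarrow> \<not> loses k ms p)"

definition optimal_win :: "nat \<Rightarrow> nat \<Rightarrow> nat \<Rightarrow> player \<Rightarrow> bool" where
  "optimal_win k w h p \<longleftrightarrow> (\<exists>s. winning_strategy k w h p s)"

definition optimal_draw :: "nat \<Rightarrow> nat \<Rightarrow> nat \<Rightarrow> bool" where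
  "optimal_draw k w h \<longleftrightarrow> (\<forall>p. \<exists>s. nonlosing_strategy k w h p s)"

end

theory Submission
  imports Defs
begin

text \<open>P2 needs a rule that always supplies a non-connecting reply, together with a reason why a play
  without any connection cannot fill the board.  The second point is easy for \<open>w \<ge> 2\<close> and
  \<open>h \<ge> 2\<close>: any two cells of a \<open>2 \<times> 2\<close> block are adjacent, so three of them already force a
  connection.

  For even \<open>h\<close>, P2 always plays on top of the piece that P1 has just placed.  Then every occupied
  column starts with an X, so by not connecting P1 keeps the occupied columns pairwise
  non-adjacent, and in each column the pieces alternate.

  For odd \<open>h\<close> and \<open>w \<ge> 2\<close>, P2 first occupies an end of the bottom row.  Whenever P1 then plays in the
  bottom row, the row contains one more X than O and has an O at one end, so by counting there are
  two X with nothing but empty cells between them (lemma \<open>consecutive_pair\<close>).  They are not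
  adjacent, as P1 has not connected, and P2 plays in the gap.  P1 may also play on top of a
  column that starts with an O; P2 then replies in the same column, where the parity of \<open>h\<close> leaves a
  free cell.  A second piece on a column that starts with an X connects at once.  These replies
  keep the invariant \<open>balanced\<close>.

  In a single row a connection-free full board alternates.  If \<open>w\<close> is odd, it cannot arise after a
  reply of P2, because then the number of pieces is even, and P2 always has a reply.  If
  \<open>w \<ge> 8\<close> is even, there is enough room for P2 to arrange, within two replies, an X and an O on cells
  of equal parity, and this excludes alternation.  For \<open>w\<close> among 2, 4 and 6 the above rule still
  shows that P2 need not lose, and a finite search shows that P1, starting in the leftmost column,
  need not lose either.  In a single column the pieces alternate in every play.\<close>

section \<open>Histories and strategies\<close>

lemma play_from_snoc:
  "play_from p (ms @ [c]) b =
     drop_piece (if even (length ms) then p else opponent p) c (play_from p ms b)"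
proof (induction ms arbitrary: p b)
  case (Cons a ms)
  show ?case by (cases p) (simp_all add: Cons.IH)
qed simp

lemma board_of_Nil [simp]: "board_of [] = (\<lambda>c. [])"
  by (simp add: board_of_def)

lemma board_of_snoc [simp]: "board_of (ms @ [c]) = drop_piece (to_move ms) c (board_of ms)"
  by (simp add: board_of_def play_from_snoc to_move_def)

lemma to_move_Nil [simp]: "to_move [] = P1"
  by (simp add: to_move_def)

lemma to_move_snoc [simp]: "to_move (ms @ [c]) = opponent (to_move ms)"
  by (simp add: to_move_def)

lemma opponent_neq [simp]: "opponent p \<noteq> p" "p \<noteq> opponent p"
  by (cases p; simp)+

lemma opponent_opponent [simp]: "opponent (opponent p) = p"
  by (cases p) simp_all

lemma neq_iff_opponent: "p \<noteq> q \<longleftrightarrow> p = opponent q"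
  by (cases p; cases q) simp_all

lemma ex_player: "(\<exists>p. P p) \<longleftrightarrow> P P1 \<or> P P2"
  by (metis player.exhaust)

lemma legal_history_Nil [simp]: "legal_history k w h []"
  by (simp add: legal_history_def)

lemma legal_history_snoc [simp]:
  "legal_history k w h (ms @ [c]) \<longleftrightarrow> legal_history k w h ms \<and> legal_move k w h ms c"
  by (auto simp: legal_history_def less_Suc_eq nth_append)

lemma follows_snoc [simp]:
  "follows p s (ms @ [c]) \<longleftrightarrow> follows p s ms \<and> (to_move ms = p \<longrightarrow> c = s ms)"
  by (auto simp: follows_def less_Suc_eq nth_append)

lemma drop_piece_apply: "drop_piece p c b d = (if d = c then b d @ [p] else b d)"
  by (simp add: drop_piece_def)

lemma legal_history_height: "legal_history k w h ms \<Longrightarrow> length (board_of ms c) \<le> h"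
  by (induction ms rule: rev_induct) (auto simp: drop_piece_apply legal_move_def)

lemma legal_move_exists:
  assumes "legal_history k w h ms" "\<not> game_over k w h ms"
  shows "\<exists>c. legal_move k w h ms c"
proof -
  obtain c where "c < w" "length (board_of ms c) \<noteq> h"
    using assms(2) by (auto simp: game_over_def full_def)
  with legal_history_height[OF assms(1), of c] assms(2) show ?thesis
    by (auto simp: legal_move_def)
qed

text \<open>A property of histories yields a strategy if \<open>p\<close> can always move so as to keep it and the other
  player cannot destroy it.  The resulting strategy also has to move legally in positions
  outside the property, which \<open>p\<close> never meets when following it.\<close>

lemma strategy_from_invariant:
  assumes start: "I []"
    and other: "\<And>ms c. I ms \<Longrightarrow> to_move ms \<noteq> p \<Longrightarrow> legal_move k w h ms c \<Longrightarrow> I (ms @ [c])"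
    and own: "\<And>ms. I ms \<Longrightarrow> to_move ms = p \<Longrightarrow> \<not> game_over k w h ms \<Longrightarrow>
                 \<exists>c. legal_move k w h ms c \<and> I (ms @ [c])"
  shows "\<exists>s. strategy_for k w h p s \<and>
           (\<forall>ms. legal_history k w h ms \<and> follows p s ms \<longrightarrow> I ms)"
proof -
  define s where "s ms = (SOME c. legal_move k w h ms c \<and>
    (I ms \<and> to_move ms = p \<longrightarrow> I (ms @ [c])))" for ms
  have s: "legal_move k w h ms (s ms) \<and> (I ms \<and> to_move ms = p \<longrightarrow> I (ms @ [s ms]))"
    if "legal_history k w h ms" "\<not> game_over k w h ms" for ms
  proof -
    have "\<exists>c. legal_move k w h ms c \<and> (I ms \<and> to_move ms = p \<longrightarrow> I (ms @ [c]))"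
      using legal_move_exists[OF that] own[of ms] that(2) by blast
    then show ?thesis unfolding s_def by (rule someI_ex)
  qed
  have "I ms" if "legal_history k w h ms" "follows p s ms" for ms
    using that
  proof (induction ms rule: rev_induct)
    case Nil
    show ?case by (rule start)
  next
    case (snoc c ms)
    have "\<not> game_over k w h ms" using snoc.prems by (simp add: legal_move_def)
    then show ?case
      using snoc s[of ms] other[of ms c] by (cases "to_move ms = p") auto
  qed
  moreover have "strategy_for k w h p s"
    using s by (auto simp: strategy_for_def)
  ultimately show ?thesis by blast
qed

text \<open>A player's move can only complete lines of that player, so P2 has to watch only P2's own moves.\<close>

lemma connects_drop_piece_other:
  assumes "p \<noteq> q" "\<not> connects k b p"
  shows "\<not> connects k (drop_piece q c b) p"
proof -
  have "piece_at b p x y" if "piece_at (drop_piece q c b) p x y" for x y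
    using that assms(1)
    by (auto simp: piece_at_def drop_piece_apply nth_append less_Suc_eq split: if_splits)
  note old = this
  show ?thesis
  proof
    assume "connects k (drop_piece q c b) p"
    then obtain x y dx dy where line: "(dx, dy) \<in> {(1, 0), (0, 1), (1, 1), (1, - 1)}"
      "\<forall>i<k. piece_at (drop_piece q c b) p (x + int i * dx) (y + int i * dy)"
      unfolding connects_def by (elim exE conjE)
    have "\<forall>i<k. piece_at b p (x + int i * dx) (y + int i * dy)"
      using line(2) old by simp
    with line(1) have "connects k b p"
      unfolding connects_def by (intro exI conjI)
    with assms(2) show False ..
  qed
qed

text \<open>For P2 it suffices to describe the boards \<open>Q\<close> to be reached after each reply, because the position
  in between is determined by P1's move.  The reply is demanded even when P1's move
  might have filled the board; hence a play that ends without a connection ends after a reply of P2,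
  in a board satisfying \<open>Q\<close>.\<close>

lemma strategy_of_replies:
  assumes start: "Q (\<lambda>c. [])"
    and reply: "\<And>b c. Q b \<Longrightarrow> c < w \<Longrightarrow> length (b c) < h \<Longrightarrow>
          \<not> connects k (drop_piece P1 c b) P1 \<Longrightarrow>
          \<exists>d<w. length (drop_piece P1 c b d) < h \<and> Q (drop_piece P2 d (drop_piece P1 c b))"
    and safe: "\<And>b. Q b \<Longrightarrow> \<not> connects k b P2"
  shows "\<exists>s. strategy_for k w h P2 s \<and>
           (\<forall>ms. complete_play k w h ms \<and> follows P2 s ms \<longrightarrow>
              \<not> loses k ms P2 \<and> (loses k ms P1 \<or> full w h (board_of ms) \<and> Q (board_of ms)))"
proof -
  define I where "I ms \<longleftrightarrow>
    (if to_move ms = P1 then Q (board_of ms)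
     else \<not> connects k (board_of ms) P2 \<and> (connects k (board_of ms) P1 \<or>
        (\<exists>d<w. length (board_of ms d) < h \<and> Q (drop_piece P2 d (board_of ms)))))" for ms
  have "\<exists>s. strategy_for k w h P2 s \<and>
           (\<forall>ms. legal_history k w h ms \<and> follows P2 s ms \<longrightarrow> I ms)"
  proof (rule strategy_from_invariant)
    show "I []" by (simp add: I_def start)
  next
    fix ms c
    assume "I ms" "to_move ms \<noteq> P2" "legal_move k w h ms c"
    then show "I (ms @ [c])"
      using reply[of "board_of ms" c] safe connects_drop_piece_other[of P2 P1 k "board_of ms" c]
      by (cases "to_move ms") (auto simp: I_def legal_move_def)
  next
    fix ms
    assume "I ms" "to_move ms = P2" "\<not> game_over k w h ms"
    then show "\<exists>c. legal_move k w h ms c \<and> I (ms @ [c])"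
      by (auto simp: I_def legal_move_def game_over_def)
  qed
  then obtain s where s: "strategy_for k w h P2 s"
    and inv: "\<And>ms. legal_history k w h ms \<Longrightarrow> follows P2 s ms \<Longrightarrow> I ms" by blast
  have "\<not> loses k ms P2 \<and> (loses k ms P1 \<or> full w h (board_of ms) \<and> Q (board_of ms))"
    if "complete_play k w h ms" "follows P2 s ms" for ms
  proof -
    have I: "I ms" and over: "game_over k w h ms"
      using that inv by (auto simp: complete_play_def)
    have no2: "\<not> connects k (board_of ms) P2"
      using I safe by (auto simp: I_def split: if_splits)
    then have "connects k (board_of ms) P1 \<or> full w h (board_of ms)"
      using over unfolding game_over_def by (auto simp: ex_player)
    then show ?thesis
      using I no2 unfolding loses_def I_def full_def by (auto split: if_splits)
  qed
  with s show ?thesis by blast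
qed

lemma P2_win_of_replies:
  assumes "Q (\<lambda>c. [])"
    and "\<And>b c. Q b \<Longrightarrow> c < w \<Longrightarrow> length (b c) < h \<Longrightarrow>
          \<not> connects k (drop_piece P1 c b) P1 \<Longrightarrow>
          \<exists>d<w. length (drop_piece P1 c b d) < h \<and> Q (drop_piece P2 d (drop_piece P1 c b))"
    and "\<And>b. Q b \<Longrightarrow> \<not> connects k b P2"
    and not_full: "\<And>b. Q b \<Longrightarrow> full w h b \<Longrightarrow> connects k b P1"
  shows "optimal_win k w h P2"
proof -
  obtain s where "strategy_for k w h P2 s"
    and *: "\<And>ms. complete_play k w h ms \<Longrightarrow> follows P2 s ms \<Longrightarrow>
       loses k ms P1 \<or> full w h (board_of ms) \<and> Q (board_of ms)"
    using strategy_of_replies[OF assms(1-3)] by blast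
  moreover have "loses k ms P1" if "complete_play k w h ms" "follows P2 s ms" for ms
    using *[OF that] not_full[of "board_of ms"] unfolding loses_def by blast
  ultimately have "winning_strategy k w h P2 s"
    by (simp add: winning_strategy_def)
  then show ?thesis
    unfolding optimal_win_def by blast
qed

section \<open>Adjacent pieces\<close>

lemma piece_at_of_nat: "piece_at b p (int c) (int i) \<longleftrightarrow> i < length (b c) \<and> b c ! i = p"
  by (simp add: piece_at_def)

lemma connects_two_line:
  "connects 2 b p \<longleftrightarrow>
     (\<exists>x y dx dy. (dx, dy) \<in> {(1, 0), (0, 1), (1, 1), (1, - 1)} \<and>
        piece_at b p x y \<and> piece_at b p (x + dx) (y + dy))"
proof -
  have "(\<forall>i<2. P i) \<longleftrightarrow> P 0 \<and> P 1" for P :: "nat \<Rightarrow> bool"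
    by (auto simp: less_2_cases_iff)
  then show ?thesis unfolding connects_def by simp
qed

text \<open>The three directions with a horizontal component merge into one case, and integer coordinates
  give way to positions in stacks.\<close>

lemma connects_two_iff:
  "connects 2 b p \<longleftrightarrow>
     (\<exists>c i. Suc i < length (b c) \<and> b c ! i = p \<and> b c ! Suc i = p) \<or>
     (\<exists>c i j. i < length (b c) \<and> j < length (b (Suc c)) \<and> i \<le> Suc j \<and> j \<le> Suc i \<and>
        b c ! i = p \<and> b (Suc c) ! j = p)" (is "?L \<longleftrightarrow> ?V \<or> ?H")
proof
  assume ?L
  then obtain x y dx dy where d: "(dx, dy) \<in> {(1, 0), (0, 1), (1, 1), (1, - 1::int)}"
    and p0: "piece_at b p x y" and p1: "piece_at b p (x + dx) (y + dy)"
    unfolding connects_two_line by blast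
  from p0 obtain c i where ci: "x = int c" "y = int i"
    by (metis piece_at_def nonneg_int_cases)
  from p1 obtain d j where dj: "x + dx = int d" "y + dy = int j"
    by (metis piece_at_def nonneg_int_cases)
  have pieces: "i < length (b c)" "b c ! i = p" "j < length (b d)" "b d ! j = p"
    using p0[unfolded ci] p1[unfolded dj] by (simp_all only: piece_at_of_nat)
  have "d = c \<and> j = Suc i \<or> d = Suc c \<and> i \<le> Suc j \<and> j \<le> Suc i"
    using d ci dj by auto
  with pieces show "?V \<or> ?H" by blast
next
  assume "?V \<or> ?H"
  then show ?L
  proof
    assume ?V
    then obtain c i where "Suc i < length (b c)" "b c ! i = p" "b c ! Suc i = p" by blast
    then have "piece_at b p (int c) (int i)" "piece_at b p (int c + 0) (int i + 1)"
      using piece_at_of_nat[of b p c i] piece_at_of_nat[of b p c "Suc i"] by (simp_all add: add.commute)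
    then show ?L unfolding connects_two_line
      by (intro exI[of _ "int c"] exI[of _ "int i"] exI[of _ 0] exI[of _ 1]) simp
  next
    assume ?H
    then obtain c i j where *: "i < length (b c)" "j < length (b (Suc c))" "i \<le> Suc j" "j \<le> Suc i"
      "b c ! i = p" "b (Suc c) ! j = p" by blast
    have "piece_at b p (int c) (int i)" "piece_at b p (int c + 1) (int i + (int j - int i))"
      using * piece_at_of_nat[of b p c i] piece_at_of_nat[of b p "Suc c" j] by (simp_all add: add.commute)
    moreover have "int j - int i \<in> {0, 1, - 1}"
      using * by auto
    ultimately show ?L unfolding connects_two_line
      by (intro exI[of _ "int c"] exI[of _ "int i"] exI[of _ 1] exI[of _ "int j - int i"]) simp
  qed
qed

lemma connects_vertical: "Suc i < length (b c) \<Longrightarrow> b c ! i = p \<Longrightarrow> b c ! Suc i = p \<Longrightarrow> connects 2 b p"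
  by (auto simp: connects_two_iff)

lemma connects_sideways:
  assumes "i < length (b c)" "j < length (b d)" "i \<le> Suc j" "j \<le> Suc i" "d = Suc c \<or> c = Suc d"
    "b c ! i = p" "b d ! j = p"
  shows "connects 2 b p"
  using assms(5)
proof
  assume "d = Suc c"
  with assms show ?thesis unfolding connects_two_iff by blast
next
  assume "c = Suc d"
  with assms show ?thesis unfolding connects_two_iff by blast
qed

lemma full_block_connects:
  assumes "full w h b" "w \<ge> 2" "h \<ge> 2"
  shows "\<exists>p. connects 2 b p"
proof -
  have len: "length (b 0) \<ge> 2" "length (b 1) \<ge> 2"
    using assms by (auto simp: full_def)
  then have pos: "Suc 0 < length (b 0)" "0 < length (b 0)" "1 < length (b 0)" "0 < length (b 1)"
    by linarith+
  have "b 0 ! 0 = b 0 ! 1 \<or> b 0 ! 0 = b 1 ! 0 \<or> b 0 ! 1 = b 1 ! 0"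
    by (cases "b 0 ! 0"; cases "b 0 ! 1"; cases "b 1 ! 0") simp_all
  then consider "b 0 ! 0 = b 0 ! 1" | "b 0 ! 0 = b 1 ! 0" | "b 0 ! 1 = b 1 ! 0"
    by blast
  then show ?thesis
  proof cases
    case 1
    with pos show ?thesis using connects_vertical[of 0 b 0] by auto
  next
    case 2
    with pos show ?thesis using connects_sideways[of 0 b 0 0 1] by auto
  next
    case 3
    with pos show ?thesis using connects_sideways[of 1 b 0 0 1] by auto
  qed
qed

definition alternating :: "player \<Rightarrow> player list \<Rightarrow> bool" where
  "alternating p s \<longleftrightarrow> (\<forall>i<length s. s ! i = (if even i then p else opponent p))"

lemma alternating_Nil [simp]: "alternating p []"
  by (simp add: alternating_def)

lemma alternating_snoc:
  "alternating p (s @ [q]) \<longleftrightarrow> alternating p s \<and> q = (if even (length s) then p else opponent p)"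
  by (simp add: alternating_def All_less_Suc nth_append conj_commute)

lemma alternating_snoc2:
  "alternating p (s @ [q, r]) \<longleftrightarrow>
     alternating p s \<and> q = (if even (length s) then p else opponent p) \<and> r = opponent q"
  using alternating_snoc[of p "s @ [q]" r] alternating_snoc[of p s q] by auto

lemma alternating_nth: "alternating p s \<Longrightarrow> i < length s \<Longrightarrow> s ! i = (if even i then p else opponent p)"
  by (simp add: alternating_def)

section \<open>A single column\<close>

lemma single_column_board:
  assumes "legal_history k 1 h ms"
  shows "alternating P1 (board_of ms 0) \<and> length (board_of ms 0) = length ms \<and> (\<forall>c>0. board_of ms c = [])"
  using assms
proof (induction ms rule: rev_induct)
  case (snoc c ms)
  then have c: "c = 0" and hist: "legal_history k 1 h ms" by (auto simp: legal_move_def)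
  have "alternating P1 (board_of ms 0)" "length (board_of ms 0) = length ms"
    "\<And>c. c > 0 \<Longrightarrow> board_of ms c = []"
    using snoc.IH[OF hist] by blast+
  then show ?case
    by (simp add: c drop_piece_apply alternating_snoc to_move_def)
qed simp

lemma single_column_drawn:
  assumes "complete_play 2 1 h ms"
  shows "drawn 2 1 h ms"
proof -
  let ?b = "board_of ms"
  have b: "alternating P1 (?b 0)" "\<forall>c>0. ?b c = []"
    using assms single_column_board[of 2 h ms] by (simp_all add: complete_play_def)
  have "\<not> connects 2 ?b p" for p
  proof
    assume "connects 2 ?b p"
    then consider c i where "Suc i < length (?b c)" "?b c ! i = p" "?b c ! Suc i = p"
      | c j where "j < length (?b (Suc c))"
      unfolding connects_two_iff by blast
    then show False
    proof cases
      case 1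
      then have "c = 0" using b(2) by (cases c) auto
      with 1 alternating_nth[OF b(1), of i] alternating_nth[OF b(1), of "Suc i"] show False
        by (simp split: if_splits)
    next
      case 2
      then show False using b(2) by simp
    qed
  qed
  then show ?thesis
    using assms by (simp add: drawn_def complete_play_def game_over_def)
qed

lemma single_column_optimal_draw: "optimal_draw 2 1 h"
proof -
  have "\<exists>s. nonlosing_strategy 2 1 h p s" for p
  proof -
    have "\<exists>s. strategy_for 2 1 h p s \<and>
           (\<forall>ms. legal_history 2 1 h ms \<and> follows p s ms \<longrightarrow> legal_history 2 1 h ms)"
    proof (rule strategy_from_invariant)
      show "\<exists>c. legal_move 2 1 h ms c \<and> legal_history 2 1 h (ms @ [c])"
        if "legal_history 2 1 h ms" "\<not> game_over 2 1 h ms" for ms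
        using legal_move_exists[OF that] that(1) by simp
    qed simp_all
    then obtain s where "strategy_for 2 1 h p s" by blast
    moreover have "\<not> loses 2 ms p" if "complete_play 2 1 h ms" for ms
      using single_column_drawn[OF that] by (simp add: loses_def drawn_def)
    ultimately show ?thesis
      unfolding nonlosing_strategy_def by blast
  qed
  then show ?thesis by (simp add: optimal_draw_def)
qed

section \<open>Even height\<close>

text \<open>P2 answers in the column of P1's move.  Adjacent occupied columns would have adjacent X at the bottom,
  so the only neighbours of P2's pieces are the X above and below.\<close>

lemma even_height_P2_win:
  assumes "even h" "h \<ge> 2" "w \<ge> 2"
  shows "optimal_win 2 w h P2"
proof -
  define Q where "Q b \<longleftrightarrow> (\<forall>c. alternating P1 (b c) \<and> even (length (b c))) \<and> \<not> connects 2 b P2" for b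
  show ?thesis
  proof (rule P2_win_of_replies)
    show "Q (\<lambda>c. [])" by (simp add: Q_def connects_two_iff)
  next
    fix b c
    let ?b1 = "drop_piece P1 c b"
    let ?b2 = "drop_piece P2 c ?b1"
    assume Q: "Q b" and c: "c < w" "length (b c) < h" and no1: "\<not> connects 2 ?b1 P1"
    have alt_b: "alternating P1 (b d)" "even (length (b d))" for d
      using Q by (simp_all add: Q_def)
    have alt: "alternating P1 (?b2 d)" "even (length (?b2 d))" for d
      by (simp_all add: drop_piece_apply alternating_snoc2 alt_b)
    \<comment> \<open>P1 is always the first to play in a column.\<close>
    have bottoms: "?b1 d ! 0 = P1" if "?b1 d \<noteq> []" for d
    proof (cases "b d = []")
      case True
      with that show ?thesis by (simp add: drop_piece_apply split: if_splits)
    next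
      case False
      with alternating_nth[OF alt_b(1), of 0 d] show ?thesis
        by (cases "d = c") (simp_all add: drop_piece_apply nth_append)
    qed
    have apart: "?b1 d = [] \<or> ?b1 (Suc d) = []" for d
    proof (rule ccontr)
      assume occupied: "\<not> ?thesis"
      have "connects 2 ?b1 P1"
      proof (rule connects_sideways)
        show "0 < length (?b1 d)" "0 < length (?b1 (Suc d))" using occupied by auto
        show "?b1 d ! 0 = P1" "?b1 (Suc d) ! 0 = P1" using occupied bottoms by blast+
      qed simp_all
      with no1 show False ..
    qed
    have "\<not> connects 2 ?b2 P2"
    proof
      assume "connects 2 ?b2 P2"
      then consider d i where "Suc i < length (?b2 d)" "?b2 d ! i = P2" "?b2 d ! Suc i = P2"
        | d i j where "i < length (?b2 d)" "j < length (?b2 (Suc d))"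
        unfolding connects_two_iff by blast
      then show False
      proof cases
        case 1
        then show False
          using alternating_nth[OF alt(1), of i d] alternating_nth[OF alt(1), of "Suc i" d]
          by (cases "even i") simp_all
      next
        case 2
        then have "?b2 d \<noteq> []" "?b2 (Suc d) \<noteq> []" by fastforce+
        then have "?b1 d \<noteq> []" "?b1 (Suc d) \<noteq> []" by (auto simp: drop_piece_apply)
        with apart[of d] show False by blast
      qed
    qed
    then have "Q ?b2" using alt by (simp add: Q_def)
    moreover have "length (?b1 c) < h"
    proof -
      have "Suc (length (b c)) \<noteq> h" using alt_b(2)[of c] \<open>even h\<close> by (metis even_Suc)
      with c(2) show ?thesis by (simp add: drop_piece_apply)
    qed
    ultimately show "\<exists>d<w. length (?b1 d) < h \<and> Q (drop_piece P2 d ?b1)"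
      using c(1) by blast
  next
    show "\<not> connects 2 b P2" if "Q b" for b using that by (simp add: Q_def)
  next
    show "connects 2 b P1" if "Q b" "full w h b" for b
      using full_block_connects[OF that(2)] assms(2,3) that(1) unfolding Q_def ex_player by blast
  qed
qed


section \<open>Odd height: the bottom row\<close>

text \<open>Suppose no two elements of \<open>A\<close> are consecutive in \<open>A \<union> B\<close>.  Then the immediate predecessor of an
  element of \<open>A\<close> lies in \<open>B\<close>, and this map is injective.  It is defined on all of \<open>A\<close> if \<open>0 \<in> B\<close>;
  otherwise at most the least element of \<open>A\<close> has no predecessor, while \<open>w - 1 \<in> B\<close> is not a value.
  In both cases \<open>card A \<le> card B\<close>.\<close>

lemma consecutive_pair:
  fixes A B :: "nat set"
  assumes AB: "A \<union> B \<subseteq> {..<w}" and disj: "A \<inter> B = {}" and card: "card B < card A"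
    and border: "0 \<in> B \<or> w - 1 \<in> B"
  shows "\<exists>a\<in>A. \<exists>a'\<in>A. a < a' \<and> (\<forall>z. a < z \<and> z < a' \<longrightarrow> z \<notin> A \<union> B)"
proof (rule ccontr)
  assume none: "\<not> ?thesis"
  have fin: "finite A" "finite B" using AB by (auto intro: finite_subset)
  define pred where "pred x = Max {z \<in> A \<union> B. z < x}" for x
  \<comment> \<open>The domain of \<open>pred\<close> and a set that contains its values.\<close>
  define A' where "A' = {a \<in> A. \<exists>z\<in>A \<union> B. z < a}"
  define B' where "B' = {z \<in> B. \<exists>a\<in>A. z < a}"
  have pred: "pred a \<in> A \<union> B" "pred a < a" "\<And>z. z \<in> A \<union> B \<Longrightarrow> z < a \<Longrightarrow> z \<le> pred a" if "a \<in> A'" for a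
  proof -
    have "finite {z \<in> A \<union> B. z < a}" "{z \<in> A \<union> B. z < a} \<noteq> {}"
      using fin that by (auto simp: A'_def)
    from Max_in[OF this] Max_ge[OF this(1)]
    show "pred a \<in> A \<union> B" "pred a < a" "\<And>z. z \<in> A \<union> B \<Longrightarrow> z < a \<Longrightarrow> z \<le> pred a"
      unfolding pred_def by blast+
  qed
  have "pred a \<in> B'" if a: "a \<in> A'" for a
  proof -
    have "a \<in> A" using a by (simp add: A'_def)
    have "z \<notin> A \<union> B" if "pred a < z" "z < a" for z
      using pred(3)[OF a, of z] that by fastforce
    with none pred(2)[OF a] \<open>a \<in> A\<close> have "pred a \<notin> A" by blast
    with pred(1,2)[OF a] \<open>a \<in> A\<close> show ?thesis by (auto simp: B'_def)
  qed
  moreover have "inj_on pred A'"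
  proof (rule linorder_inj_onI)
    fix a a' assume a: "a < a'" "a \<in> A'" "a' \<in> A'"
    then have "a \<le> pred a'" using pred(3)[of a' a] by (simp add: A'_def)
    with pred(2)[OF a(2)] show "pred a \<noteq> pred a'" by simp
  qed (rule linear)
  moreover have "finite B'" using fin by (simp add: B'_def)
  ultimately have le: "card A' \<le> card B'"
    by (metis card_inj_on_le image_subsetI)
  from border show False
  proof
    assume "0 \<in> B"
    then have "A' = A"
      using disj by (auto simp: A'_def intro!: bexI[of _ 0] gr0I)
    moreover have "card B' \<le> card B" using fin by (intro card_mono) (auto simp: B'_def)
    ultimately show False using le card by simp
  next
    assume w: "w - 1 \<in> B"
    have "A \<subseteq> insert (Min A) A'"
    proof
      fix a assume a: "a \<in> A"
      then have "Min A \<in> A" "Min A \<le> a" using fin(1) Min_in[of A] Min_le[of A a] by blast+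
      with a show "a \<in> insert (Min A) A'"
        unfolding A'_def by (metis (mono_tags, lifting) UnI1 insertCI le_neq_implies_less mem_Collect_eq)
    qed
    then have "card A \<le> card (insert (Min A) A')"
      using fin by (intro card_mono) (auto simp: A'_def)
    also have "\<dots> \<le> Suc (card A')" using fin by (simp add: A'_def card_insert_if)
    finally have "card A \<le> Suc (card A')" .
    moreover have "B' \<subseteq> B - {w - 1}"
    proof
      fix z assume "z \<in> B'"
      then obtain a where "z \<in> B" "a \<in> A" "z < a" by (auto simp: B'_def)
      moreover have "a < w" using \<open>a \<in> A\<close> AB by auto
      ultimately show "z \<in> B - {w - 1}" by auto
    qed
    then have "card B' \<le> card (B - {w - 1})" using fin by (intro card_mono) auto
    then have "card B' < card B"
      using w fin by (metis card_Diff1_less order_le_less_trans)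
    ultimately show False using le card by linarith
  qed
qed

text \<open>Sets of columns, rather than a sequence of colours, because P2's replies for odd height rest on
  counting the pieces of either colour in the bottom row.\<close>

definition bottoms :: "player \<Rightarrow> board \<Rightarrow> nat set" where
  "bottoms p b = {c. b c \<noteq> [] \<and> b c ! 0 = p}"

lemma bottoms_disjoint: "bottoms P1 b \<inter> bottoms P2 b = {}"
  by (auto simp: bottoms_def)

lemma bottoms_cover: "c \<notin> bottoms P1 b \<union> bottoms P2 b \<longleftrightarrow> b c = []"
  by (cases "b c ! 0") (simp_all add: bottoms_def)

lemma bottoms_drop_piece:
  "bottoms q (drop_piece p c b) = (if b c = [] \<and> p = q then insert c (bottoms q b) else bottoms q b)"
  by (auto simp: bottoms_def drop_piece_apply nth_append)

lemma bottoms_empty [simp]: "bottoms p (\<lambda>c. []) = {}"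
  by (simp add: bottoms_def)

text \<open>P2 only ever plays next to columns without any O, so heights need not be compared here.\<close>

lemma not_connects_drop_piece:
  assumes no: "\<not> connects 2 b p" and top: "b d = [] \<or> last (b d) \<noteq> p"
    and beside: "\<And>e. e = Suc d \<or> d = Suc e \<Longrightarrow> p \<notin> set (b e)"
  shows "\<not> connects 2 (drop_piece p d b) p"
proof
  let ?b = "drop_piece p d b"
  assume "connects 2 ?b p"
  then consider (vertical) c i where "Suc i < length (?b c)" "?b c ! i = p" "?b c ! Suc i = p"
    | (sideways) c i j where "i < length (?b c)" "j < length (?b (Suc c))" "i \<le> Suc j" "j \<le> Suc i"
        "?b c ! i = p" "?b (Suc c) ! j = p"
    unfolding connects_two_iff by blast
  then show False
  proof cases
    case vertical
    show False
    proof (cases "c = d \<and> Suc i = length (b d)")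
      case True
      then have ne: "b d \<noteq> []" and i: "length (b d) - 1 = i" "i < length (b d)" by auto
      have "last (b d) = p"
        using vertical(2) True i(2) unfolding last_conv_nth[OF ne] i(1)
        by (simp add: drop_piece_apply nth_append)
      with ne top show False by blast
    next
      case False
      then have "Suc i < length (b c)" "b c ! i = p" "b c ! Suc i = p"
        using vertical by (auto simp: drop_piece_apply nth_append split: if_splits)
      with no show False using connects_vertical by blast
    qed
  next
    case sideways
    consider "c = d" | "Suc c = d" | "c \<noteq> d" "Suc c \<noteq> d" by blast
    then show False
    proof cases
      case 1
      with sideways(2,6) beside[of "Suc c"] nth_mem[of j "b (Suc c)"] show False
        by (simp add: drop_piece_apply)
    next
      case 2
      then have "i < length (b c)" "b c ! i = p"
        using sideways(1,5) by (simp_all add: drop_piece_apply split: if_splits)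
      with 2 beside[of c] nth_mem[of i "b c"] show False by simp
    next
      case 3
      with sideways no show False
        using connects_sideways[of i b c j "Suc c" p] by (simp add: drop_piece_apply)
    qed
  qed
qed


text \<open>The boards that P2 aims at after each reply for odd height.  Columns that start with an X stay
  at height one, since P1 would connect by building on them; in the others P2 always has the top
  piece.  The O at an end of the bottom row is what makes the counting argument work.\<close>

definition balanced :: "nat \<Rightarrow> board \<Rightarrow> bool" where
  "balanced w b \<longleftrightarrow>
     (\<forall>c\<ge>w. b c = []) \<and>
     (\<forall>c. b c = [] \<or> b c = [P1] \<or> alternating P2 (b c) \<and> odd (length (b c))) \<and>
     card (bottoms P1 b) = card (bottoms P2 b) \<and>
     (0 \<in> bottoms P2 b \<or> w - 1 \<in> bottoms P2 b) \<and>
     \<not> connects 2 b P2"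

lemma balancedD:
  assumes "balanced w b"
  shows "c \<ge> w \<Longrightarrow> b c = []"
    and "b c = [] \<or> b c = [P1] \<or> alternating P2 (b c) \<and> odd (length (b c))"
    and "card (bottoms P1 b) = card (bottoms P2 b)"
    and "0 \<in> bottoms P2 b \<or> w - 1 \<in> bottoms P2 b"
    and "\<not> connects 2 b P2"
  using assms unfolding balanced_def by blast+

lemma balanced_bottoms_subset:
  assumes "balanced w b"
  shows "bottoms p b \<subseteq> {..<w}"
proof
  fix c assume "c \<in> bottoms p b"
  then have "b c \<noteq> []" by (simp add: bottoms_def)
  with balancedD(1)[OF assms, of c] show "c \<in> {..<w}" by (metis lessThan_iff not_le)
qed

lemma balanced_P1_bottom:
  assumes "balanced w b" "c \<in> bottoms P1 b"
  shows "b c = [P1]"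
proof -
  have c: "b c \<noteq> []" "b c ! 0 = P1" using assms(2) by (simp_all add: bottoms_def)
  then have "\<not> alternating P2 (b c)" using alternating_nth[of P2 "b c" 0] by auto
  with c balancedD(2)[OF assms(1), of c] show ?thesis by blast
qed

text \<open>Replies in the bottom row.  A neighbouring column that does not start with an O contains no O at
  all, so P2's piece cannot connect diagonally to a higher row either.\<close>

lemma balanced_bottom_reply:
  assumes bal: "balanced w b" and c: "c < w" "b c = []" and d: "d < w" "d \<noteq> c" "b d = []"
    and beside: "\<And>e. e = Suc d \<or> d = Suc e \<Longrightarrow> e \<notin> bottoms P2 b"
  shows "balanced w (drop_piece P2 d (drop_piece P1 c b))"
proof -
  let ?b1 = "drop_piece P1 c b"
  let ?b2 = "drop_piece P2 d ?b1"
  have "\<not> connects 2 ?b2 P2"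
  proof (rule not_connects_drop_piece)
    show "\<not> connects 2 ?b1 P2"
      using balancedD(5)[OF bal] by (intro connects_drop_piece_other) simp_all
    show "?b1 d = [] \<or> last (?b1 d) \<noteq> P2"
      using d by (simp add: drop_piece_apply)
    show "P2 \<notin> set (?b1 e)" if "e = Suc d \<or> d = Suc e" for e
    proof -
      have "b e = [] \<or> b e = [P1]"
        using beside[OF that] bottoms_cover[of e b] balanced_P1_bottom[OF bal, of e] by blast
      with c(2) show ?thesis by (auto simp: drop_piece_apply)
    qed
  qed
  moreover have "bottoms P1 ?b2 = insert c (bottoms P1 b)" "bottoms P2 ?b2 = insert d (bottoms P2 b)"
    using c d by (simp_all add: bottoms_drop_piece drop_piece_apply)
  moreover have "c \<notin> bottoms P1 b" "d \<notin> bottoms P2 b"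
    using c d by (simp_all add: bottoms_def)
  moreover have "finite (bottoms p b)" for p
    using balanced_bottoms_subset[OF bal] finite_subset by blast
  moreover have "?b2 e = [] \<or> ?b2 e = [P1] \<or> alternating P2 (?b2 e) \<and> odd (length (?b2 e))" for e
    using balancedD(2)[OF bal, of e] c(2) d(2,3)
    by (cases "e = c"; cases "e = d") (simp_all add: drop_piece_apply alternating_def)
  moreover have "?b2 e = []" if "e \<ge> w" for e
    using balancedD(1)[OF bal that] that c(1) d(1) by (auto simp: drop_piece_apply)
  ultimately show ?thesis
    using balancedD(3,4)[OF bal] unfolding balanced_def by auto
qed

text \<open>Replies on top of a stack.  P1's piece in the second row (or a higher one) implies that both
  neighbouring columns are empty: an X at the bottom of one of them would be diagonally adjacent to
  the X in the second row, and an O there would be adjacent to the O at the bottom of the stack.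
  Hence P2's piece touches only the X below it.\<close>

lemma balanced_stack_reply:
  assumes bal: "balanced w b" and c: "c < w" "b c \<noteq> []" "length (b c) < h" and "odd h"
    and no1: "\<not> connects 2 (drop_piece P1 c b) P1"
  shows "length (drop_piece P1 c b c) < h \<and> balanced w (drop_piece P2 c (drop_piece P1 c b))"
proof -
  let ?b1 = "drop_piece P1 c b"
  let ?b2 = "drop_piece P2 c ?b1"
  have "b c \<noteq> [P1]"
  proof
    assume "b c = [P1]"
    then have "connects 2 ?b1 P1"
      by (intro connects_vertical[of 0 _ c]) (simp_all add: drop_piece_apply)
    with no1 show False ..
  qed
  then have alt: "alternating P2 (b c)" "odd (length (b c))"
    using balancedD(2)[OF bal, of c] c(2) by blast+
  then have bot_c: "b c ! 0 = P2" using c(2) alternating_nth[OF alt(1), of 0] by simp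
  have alt1: "alternating P2 (?b1 c)"
    using alt by (simp add: drop_piece_apply alternating_snoc)
  have len1: "Suc 0 < length (?b1 c)" using c(2) by (simp add: drop_piece_apply)
  then have second: "?b1 c ! Suc 0 = P1" using alternating_nth[OF alt1, of "Suc 0"] by simp
  have empty: "b e = []" if e: "e = Suc c \<or> c = Suc e" for e
  proof (rule ccontr)
    assume ne: "b e \<noteq> []"
    have "connects 2 ?b1 P1 \<or> connects 2 b P2"
    proof (cases "b e ! 0")
      case P1
      then have "connects 2 ?b1 P1"
        using e ne len1 second
        by (intro connects_sideways[of "Suc 0" ?b1 c 0 e]) (auto simp: drop_piece_apply)
      then show ?thesis ..
    next
      case P2
      then have "connects 2 b P2"
        using e ne c(2) bot_c by (intro connects_sideways[of 0 b c 0 e]) auto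
      then show ?thesis ..
    qed
    with no1 balancedD(5)[OF bal] show False by blast
  qed
  have "\<not> connects 2 ?b2 P2"
  proof (rule not_connects_drop_piece)
    show "\<not> connects 2 ?b1 P2"
      using balancedD(5)[OF bal] by (intro connects_drop_piece_other) simp_all
    show "?b1 c = [] \<or> last (?b1 c) \<noteq> P2"
      by (simp add: drop_piece_apply)
    show "P2 \<notin> set (?b1 e)" if "e = Suc c \<or> c = Suc e" for e
      using empty[OF that] that by (auto simp: drop_piece_apply)
  qed
  moreover have "bottoms p ?b2 = bottoms p b" for p
    using c(2) by (simp add: bottoms_drop_piece drop_piece_apply)
  moreover have "?b2 e = [] \<or> ?b2 e = [P1] \<or> alternating P2 (?b2 e) \<and> odd (length (?b2 e))" for e
    using balancedD(2)[OF bal, of e] alt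
    by (cases "e = c") (simp_all add: drop_piece_apply alternating_snoc2)
  moreover have "?b2 e = []" if "e \<ge> w" for e
    using balancedD(1)[OF bal that] that c(1) by (auto simp: drop_piece_apply)
  ultimately have "balanced w ?b2"
    using balancedD(3,4)[OF bal] unfolding balanced_def by simp
  moreover have "Suc (length (b c)) \<noteq> h" using alt(2) \<open>odd h\<close> by (metis even_Suc)
  with c(3) have "length (?b1 c) < h" by (simp add: drop_piece_apply)
  ultimately show ?thesis by blast
qed

text \<open>An empty column chosen by P1 puts X in the majority in the bottom row, which opens a gap between two
  consecutive X for P2; any other column is answered in the same column.\<close>

lemma balanced_reply:
  assumes bal: "balanced w b" and c: "c < w" "length (b c) < h" and "odd h"
    and no1: "\<not> connects 2 (drop_piece P1 c b) P1"
  shows "\<exists>d<w. length (drop_piece P1 c b d) < h \<and> balanced w (drop_piece P2 d (drop_piece P1 c b))"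
proof (cases "b c = []")
  case False
  with balanced_stack_reply[OF bal c(1) _ c(2) \<open>odd h\<close> no1] c(1) show ?thesis by blast
next
  case True
  let ?b1 = "drop_piece P1 c b"
  let ?A = "insert c (bottoms P1 b)" and ?B = "bottoms P2 b"
  have A: "?A = bottoms P1 ?b1" using True by (simp add: bottoms_drop_piece)
  have cB: "c \<notin> bottoms p b" for p using True by (simp add: bottoms_def)
  have "\<exists>a\<in>?A. \<exists>a'\<in>?A. a < a' \<and> (\<forall>z. a < z \<and> z < a' \<longrightarrow> z \<notin> ?A \<union> ?B)"
  proof (rule consecutive_pair)
    show "?A \<union> ?B \<subseteq> {..<w}" using balanced_bottoms_subset[OF bal] c(1) by auto
    show "?A \<inter> ?B = {}" using bottoms_disjoint[of b] cB by blast
    have "finite (bottoms P1 b)" using balanced_bottoms_subset[OF bal] finite_subset by blast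
    then show "card ?B < card ?A" using balancedD(3)[OF bal] cB by simp
    show "0 \<in> ?B \<or> w - 1 \<in> ?B" by (rule balancedD(4)[OF bal])
  qed
  then obtain a a' where a: "a \<in> ?A" "a' \<in> ?A" "a < a'"
    and between: "\<And>z. a < z \<Longrightarrow> z < a' \<Longrightarrow> z \<notin> ?A \<union> ?B" by blast
  have "a' \<noteq> Suc a"
  proof
    assume "a' = Suc a"
    moreover have "?b1 a \<noteq> []" "?b1 a ! 0 = P1" "?b1 a' \<noteq> []" "?b1 a' ! 0 = P1"
      using a(1,2)[unfolded A] by (simp_all add: bottoms_def)
    ultimately have "connects 2 ?b1 P1"
      by (intro connects_sideways[of 0 ?b1 a 0 a']) simp_all
    with no1 show False ..
  qed
  with a(3) have gap: "Suc a < a'" by simp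
  have "a' < w" using a(2) balanced_bottoms_subset[OF bal, of P1] c(1) by auto
  have free: "Suc a \<noteq> c" "b (Suc a) = []"
    using between[of "Suc a"] gap bottoms_cover[of "Suc a" b] by auto
  have "balanced w (drop_piece P2 (Suc a) ?b1)"
  proof (rule balanced_bottom_reply[OF bal c(1) True])
    show "Suc a < w" using gap \<open>a' < w\<close> by simp
    show "e \<notin> ?B" if "e = Suc (Suc a) \<or> Suc a = Suc e" for e
    proof -
      have AB: "?A \<inter> ?B = {}" using bottoms_disjoint[of b] cB by blast
      have "e = a \<or> e = a' \<or> a < e \<and> e < a'" using that gap by auto
      then show ?thesis using a AB between[of e] by blast
    qed
  qed (use free in auto)
  moreover have "length (?b1 (Suc a)) < h"
    using free \<open>odd h\<close> by (cases h) (simp_all add: drop_piece_apply)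
  ultimately show ?thesis using gap \<open>a' < w\<close> by (intro exI[of _ "Suc a"]) simp
qed

lemma empty_not_connects [simp]: "\<not> connects 2 (\<lambda>c. []) p"
  by (simp add: connects_two_iff)

text \<open>The first reply creates the O at an end of the bottom row.\<close>

lemma balanced_opening:
  assumes "x < w" "d \<in> {0, w - 1}" "d \<noteq> x"
  shows "balanced w (drop_piece P2 d (drop_piece P1 x (\<lambda>c. [])))"
proof -
  let ?b1 = "drop_piece P1 x (\<lambda>c. [])"
  let ?b2 = "drop_piece P2 d ?b1"
  have "\<not> connects 2 ?b2 P2"
  proof (rule not_connects_drop_piece)
    show "\<not> connects 2 ?b1 P2" by (intro connects_drop_piece_other) simp_all
  qed (use assms(3) in \<open>auto simp: drop_piece_apply\<close>)
  then show ?thesis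
    using assms by (auto simp: balanced_def bottoms_drop_piece drop_piece_apply alternating_def)
qed


lemma empty_or_balanced_reply:
  assumes b: "b = (\<lambda>c. []) \<or> balanced w b" and c: "c < w" "length (b c) < h"
    and h: "odd h" and w: "w \<ge> 2"
    and no1: "\<not> connects 2 (drop_piece P1 c b) P1"
  shows "\<exists>d<w. length (drop_piece P1 c b d) < h \<and> balanced w (drop_piece P2 d (drop_piece P1 c b))"
  using b
proof
  assume empty: "b = (\<lambda>c. [])"
  define d where "d = (if c = 0 then w - 1 else 0)"
  have d: "d < w" "d \<in> {0, w - 1}" "d \<noteq> c" using w by (auto simp: d_def)
  have "length (drop_piece P1 c b d) < h"
    using d(3) h by (cases h) (simp_all add: drop_piece_apply empty)
  with balanced_opening[OF c(1) d(2,3)] d(1) show ?thesis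
    unfolding empty by blast
next
  assume "balanced w b"
  then show ?thesis using balanced_reply c h no1 by blast
qed

lemma odd_height_P2_nonlosing:
  assumes "odd h" "w \<ge> 2"
  shows "\<exists>s. nonlosing_strategy 2 w h P2 s"
proof -
  define Q where "Q b \<longleftrightarrow> b = (\<lambda>c. []) \<or> balanced w b" for b
  have "\<exists>s. strategy_for 2 w h P2 s \<and>
           (\<forall>ms. complete_play 2 w h ms \<and> follows P2 s ms \<longrightarrow>
              \<not> loses 2 ms P2 \<and> (loses 2 ms P1 \<or> full w h (board_of ms) \<and> Q (board_of ms)))"
  proof (rule strategy_of_replies)
    show "Q (\<lambda>c. [])" by (simp add: Q_def)
  next
    fix b c
    assume "Q b" "c < w" "length (b c) < h" "\<not> connects 2 (drop_piece P1 c b) P1"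
    then show "\<exists>d<w. length (drop_piece P1 c b d) < h \<and> Q (drop_piece P2 d (drop_piece P1 c b))"
      using empty_or_balanced_reply[of b w c h] assms unfolding Q_def by blast
  next
    show "\<not> connects 2 b P2" if "Q b" for b
      using that balancedD(5)[of w b] unfolding Q_def by auto
  qed
  then show ?thesis unfolding nonlosing_strategy_def by blast
qed

section \<open>Odd height: excluding full boards\<close>

lemma full_row_alternates:
  assumes full: "full w 1 b" and no: "\<And>p. \<not> connects 2 b p" and "c < w"
  shows "b c ! 0 = (if even c then b 0 ! 0 else opponent (b 0 ! 0))"
  using \<open>c < w\<close>
proof (induction c)
  case (Suc c)
  have "length (b c) = 1" "length (b (Suc c)) = 1"
    using full Suc.prems by (simp_all add: full_def)
  then have "b (Suc c) ! 0 \<noteq> b c ! 0"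
    using no connects_sideways[of 0 b c 0 "Suc c" "b c ! 0"] by auto
  then show ?case
    using Suc.IH Suc.prems by (simp add: neq_iff_opponent split: if_splits)
qed simp

text \<open>Such a pair of pieces contradicts every alternating colouring of the row, and it stays on the board
  once it is there.\<close>

definition off_parity :: "board \<Rightarrow> bool" where
  "off_parity b \<longleftrightarrow> (\<exists>i\<in>bottoms P1 b. \<exists>j\<in>bottoms P2 b. even i \<longleftrightarrow> even j)"

lemma off_parity_drop_piece: "off_parity b \<Longrightarrow> off_parity (drop_piece p c b)"
  unfolding off_parity_def by (auto simp: bottoms_drop_piece)

lemma off_parity_full_row:
  assumes "off_parity b" "full w 1 b" "\<And>c. c \<ge> w \<Longrightarrow> b c = []"
  shows "\<exists>p. connects 2 b p"
proof (rule ccontr)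
  assume "\<not> ?thesis"
  then have no: "\<And>p. \<not> connects 2 b p" by blast
  obtain i j where ij: "b i \<noteq> []" "b i ! 0 = P1" "b j \<noteq> []" "b j ! 0 = P2" "even i \<longleftrightarrow> even j"
    using assms(1) unfolding off_parity_def bottoms_def by blast
  have "i < w" "j < w" using ij(1,3) assms(3) by (metis not_le)+
  with full_row_alternates[OF assms(2) no] ij(2,4,5) show False
    by (metis player.distinct(1))
qed

lemma balanced_full_row_even:
  assumes "balanced w b" "full w 1 b"
  shows "even w"
proof -
  have "c \<in> bottoms P1 b \<union> bottoms P2 b" if "c < w" for c
    using assms(2) that bottoms_cover[of c b] by (auto simp: full_def)
  then have cover: "bottoms P1 b \<union> bottoms P2 b = {..<w}"
    using balanced_bottoms_subset[OF assms(1)] by blast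
  then have "finite (bottoms P1 b)" "finite (bottoms P2 b)"
    by (metis finite_Un finite_lessThan)+
  then have "card {..<w} = card (bottoms P1 b) + card (bottoms P2 b)"
    unfolding cover[symmetric] using bottoms_disjoint by (rule card_Un_disjoint)
  then show ?thesis using balancedD(3)[OF assms(1)] by simp
qed

text \<open>A full board after a reply of P2 is excluded by the \<open>2 \<times> 2\<close> block or, in a single row, by the
  even number of pieces.\<close>

lemma odd_height_P2_win:
  assumes "odd h" "w \<ge> 2" "h \<ge> 2 \<or> odd w"
  shows "optimal_win 2 w h P2"
proof -
  define Q where "Q b \<longleftrightarrow> b = (\<lambda>c. []) \<or> balanced w b" for b
  have safe: "\<not> connects 2 b P2" if "Q b" for b
    using that balancedD(5)[of w b] unfolding Q_def by auto
  show ?thesis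
  proof (rule P2_win_of_replies[OF _ _ safe])
    show "Q (\<lambda>c. [])" by (simp add: Q_def)
  next
    fix b c
    assume "Q b" "c < w" "length (b c) < h" "\<not> connects 2 (drop_piece P1 c b) P1"
    then show "\<exists>d<w. length (drop_piece P1 c b d) < h \<and> Q (drop_piece P2 d (drop_piece P1 c b))"
      using empty_or_balanced_reply[of b w c h] assms(1,2) unfolding Q_def by blast
  next
    fix b assume "Q b" and full: "full w h b"
    have "h > 0" using \<open>odd h\<close> by (cases h) simp_all
    moreover have "length (b 0) = h" using full \<open>w \<ge> 2\<close> by (simp add: full_def)
    ultimately have "b \<noteq> (\<lambda>c. [])" by auto
    with \<open>Q b\<close> have bal: "balanced w b" by (simp add: Q_def)
    show "connects 2 b P1"
    proof (cases "h \<ge> 2")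
      case True
      then show ?thesis
        using full_block_connects[OF full \<open>w \<ge> 2\<close>] safe[OF \<open>Q b\<close>] unfolding ex_player by blast
    next
      case False
      with \<open>h > 0\<close> have "h = 1" by simp
      with balanced_full_row_even[OF bal] full assms(3) show ?thesis by simp
    qed
  qed
qed

text \<open>P2 wants a bottom row that is off parity.  If P1 starts in an inner cell, P2 achieves this at once
  by occupying the end of the same parity; the two ends have different parities.  If P1 starts at an
  end, P2 takes the other end.  Should P1's second piece leave the row on parity, then P2 places an O
  on a cell of the parity of P1's end, away from P2's end.  At least two such inner cells are
  available for \<open>w \<ge> 8\<close>, and P1 has occupied at most one of them.  For \<open>w = 6\<close> there is only
  one, and P1 can take it.\<close>

lemma even_single_row_P2_win:
  assumes w: "even w" "w \<ge> 8"
  shows "optimal_win 2 w 1 P2"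
proof -
  obtain r where r: "w = Suc r" using w(2) by (cases w) auto
  define opened :: "nat \<Rightarrow> nat \<Rightarrow> board" where
    "opened x d = drop_piece P2 d (drop_piece P1 x (\<lambda>c. []))" for x d
  \<comment> \<open>Balanced boards are admitted while still on parity only if they consist of the two end pieces.\<close>
  define Q where "Q b \<longleftrightarrow> b = (\<lambda>c. []) \<or>
    balanced w b \<and> (off_parity b \<or> b = opened 0 (r) \<or> b = opened (r) 0)" for b
  have bottoms_opened: "bottoms P1 (opened x d) = {x}" "bottoms P2 (opened x d) = {d}"
    if "d \<noteq> x" for x d
    using that by (simp_all add: opened_def bottoms_drop_piece drop_piece_apply)
  have opened_apply: "opened x d e = (if e = d then [P2] else if e = x then [P1] else [])"
    if "d \<noteq> x" for x d e
    using that by (simp add: opened_def drop_piece_apply)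
  have w1: "odd (r)" "r \<ge> 7" using w r by auto
  show ?thesis
  proof (rule P2_win_of_replies)
    show "Q (\<lambda>c. [])" by (simp add: Q_def)
  next
    fix b c
    let ?b1 = "drop_piece P1 c b"
    let ?goal = "\<exists>d<w. length (?b1 d) < 1 \<and> Q (drop_piece P2 d ?b1)"
    assume "Q b" and c: "c < w" "length (b c) < 1" and no1: "\<not> connects 2 ?b1 P1"
    have reply_off: ?goal if bal: "balanced w b" and off: "off_parity ?b1"
      using balanced_reply[OF bal c _ no1] off_parity_drop_piece[OF off] unfolding Q_def by auto
    have breaking: ?goal
      if "balanced w b" "d < w" "d \<noteq> c" "b d = []" "\<And>e. e = Suc d \<or> d = Suc e \<Longrightarrow> e \<notin> bottoms P2 b"
        "i \<in> bottoms P1 b" "even i \<longleftrightarrow> even d" for d i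
    proof -
      have "balanced w (drop_piece P2 d ?b1)"
        using that c by (intro balanced_bottom_reply) simp_all
      moreover have "off_parity (drop_piece P2 d ?b1)"
        using that unfolding off_parity_def by (auto simp: bottoms_drop_piece drop_piece_apply)
      moreover have "length (?b1 d) < 1" using that by (simp add: drop_piece_apply)
      ultimately show ?goal using that(2) unfolding Q_def by blast
    qed
    from \<open>Q b\<close> consider (empty) "b = (\<lambda>c. [])" | (off) "balanced w b" "off_parity b"
      | (left) "balanced w b" "b = opened 0 (r)"
      | (right) "balanced w b" "b = opened (r) 0"
      unfolding Q_def by blast
    then show ?goal
    proof cases
      case empty
      have reply: ?goal if "d \<in> {0, r}" "d \<noteq> c"
        "off_parity (opened c d) \<or> opened c d = opened 0 (r) \<or> opened c d = opened (r) 0" for d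
      proof -
        have "drop_piece P2 d ?b1 = opened c d" by (simp add: opened_def empty)
        moreover have "balanced w (opened c d)"
          using balanced_opening[OF c(1), of d] that(1,2) by (simp add: opened_def r)
        ultimately have "Q (drop_piece P2 d ?b1)" using that(3) unfolding Q_def by metis
        moreover have "length (?b1 d) < 1" using that(2) by (simp add: drop_piece_apply empty)
        moreover have "d < w" using that(1) r by auto
        ultimately show ?goal by blast
      qed
      have off: "off_parity (opened c d)" if "d \<noteq> c" "even c \<longleftrightarrow> even d" for d
        using that by (simp add: off_parity_def bottoms_opened)
      consider "c = 0" | "c = r" | "c \<noteq> 0" "even c" | "c \<noteq> r" "odd c" by blast
      then show ?goal
      proof cases
        case 1
        then show ?goal using reply[of "r"] w1 by auto
      next
        case 2
        then show ?goal using reply[of 0] w1 by auto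
      next
        case 3
        then show ?goal using reply[of 0] off[of 0] by auto
      next
        case 4
        then show ?goal using reply[of "r"] off[of "r"] w1 by auto
      qed
    next
      case off
      then show ?goal using reply_off off_parity_drop_piece by blast
    next
      case left
      have wne: "r \<noteq> 0" using w1 by simp
      note bots = bottoms_opened[OF wne] and app = opened_apply[OF wne]
      show ?goal
      proof (cases "odd c")
        case True
        then have "off_parity ?b1"
          using w1 c(2) unfolding off_parity_def left(2) by (auto simp: bottoms_drop_piece bots)
        with left(1) show ?goal by (rule reply_off)
      next
        case False
        define d where "d = (if c = 2 then 4 else 2::nat)"
        show ?goal
        proof (rule breaking[of d 0])
          show "balanced w b" by (rule left(1))
          show "d < w" "d \<noteq> c" "even 0 \<longleftrightarrow> even d" using r w1 by (auto simp: d_def)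
          show "b d = []" "0 \<in> bottoms P1 b"
            unfolding left(2) using w1 by (auto simp: app bots d_def)
          show "e \<notin> bottoms P2 b" if "e = Suc d \<or> d = Suc e" for e
            unfolding left(2) using w1 that by (auto simp: bots d_def split: if_splits)
        qed
      qed
    next
      case right
      have wne: "0 \<noteq> r" using w1 by simp
      note bots = bottoms_opened[OF wne] and app = opened_apply[OF wne]
      show ?goal
      proof (cases "even c")
        case True
        then have "off_parity ?b1"
          using w1 c(2) unfolding off_parity_def right(2) by (auto simp: bottoms_drop_piece bots)
        with right(1) show ?goal by (rule reply_off)
      next
        case False
        define d where "d = (if c = 3 then 5 else 3::nat)"
        show ?goal
        proof (rule breaking[of d "r"])
          show "balanced w b" by (rule right(1))
          show "d < w" "d \<noteq> c" "even (r) \<longleftrightarrow> even d" using r w1 False by (auto simp: d_def)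
          show "b d = []" "r \<in> bottoms P1 b"
            unfolding right(2) using w1 by (auto simp: app bots d_def)
          show "e \<notin> bottoms P2 b" if "e = Suc d \<or> d = Suc e" for e
            unfolding right(2) using w1 that by (auto simp: bots d_def split: if_splits)
        qed
      qed
    qed
  next
    show "\<not> connects 2 b P2" if "Q b" for b
      using that balancedD(5)[of w b] unfolding Q_def by auto
  next
    fix b assume "Q b" and full: "full w 1 b"
    have len: "length (b c) = 1" if "c < 2" for c
      using that full w by (simp add: full_def)
    then have "b \<noteq> (\<lambda>c. [])" by fastforce
    moreover have "b \<noteq> opened x d" if "x \<in> {0, r}" "d \<in> {0, r}" "d \<noteq> x" for x d
    proof
      assume "b = opened x d"
      then have "b 1 = []" using that w1 opened_apply[OF that(3), of 1] by auto
      with len[of 1] show False by simp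
    qed
    ultimately have "balanced w b" "off_parity b" using \<open>Q b\<close> w1 unfolding Q_def by auto
    then show "connects 2 b P1"
      using off_parity_full_row[OF _ full] balancedD(1,5)[of w b] unfolding ex_player by blast
  qed
qed


section \<open>Single rows of width 2, 4 and 6\<close>

definition adjacent_pair :: "nat list \<Rightarrow> bool" where
  "adjacent_pair xs \<longleftrightarrow> (\<exists>a\<in>set xs. Suc a \<in> set xs)"

text \<open>\<open>survives n w xs ys\<close> says that in a single row with X on \<open>xs\<close>, O on \<open>ys\<close> and P2 to move, P1 can
  avoid connecting; \<open>n\<close> bounds the number of P2's remaining moves and makes the search terminate.\<close>

fun survives :: "nat \<Rightarrow> nat \<Rightarrow> nat list \<Rightarrow> nat list \<Rightarrow> bool" where
  "survives 0 w xs ys \<longleftrightarrow> False"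
| "survives (Suc n) w xs ys \<longleftrightarrow>
     (\<forall>c\<in>set [0..<w]. c \<in> set xs \<or> c \<in> set ys \<or> adjacent_pair (c # ys) \<or>
        (\<forall>d\<in>set [0..<w]. d \<in> set xs \<or> d \<in> set (c # ys)) \<or>
        (\<exists>d\<in>set [0..<w]. d \<notin> set xs \<and> d \<notin> set (c # ys) \<and> \<not> adjacent_pair (d # xs) \<and>
           survives n w (d # xs) (c # ys)))"

lemma survives_2: "survives 1 2 [0] []" by code_simp
lemma survives_4: "survives 2 4 [0] []" by code_simp
lemma survives_6: "survives 3 6 [0] []" by code_simp

definition row_board :: "nat list \<Rightarrow> nat list \<Rightarrow> board" where
  "row_board xs ys = (\<lambda>c. if c \<in> set xs then [P1] else if c \<in> set ys then [P2] else [])"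

lemma row_board_drop:
  assumes "c \<notin> set xs" "c \<notin> set ys"
  shows "drop_piece P1 c (row_board xs ys) = row_board (c # xs) ys"
    and "drop_piece P2 c (row_board xs ys) = row_board xs (c # ys)"
  using assms by (auto simp: row_board_def drop_piece_def)

lemma row_board_connects:
  assumes "set xs \<inter> set ys = {}"
  shows "connects 2 (row_board xs ys) P1 \<longleftrightarrow> adjacent_pair xs"
    and "connects 2 (row_board xs ys) P2 \<longleftrightarrow> adjacent_pair ys"
proof -
  define cells where "cells p = (if p = P1 then set xs else set ys)" for p
  have row: "i < length (row_board xs ys c) \<and> row_board xs ys c ! i = p \<longleftrightarrow>
      i = 0 \<and> c \<in> cells p" for i c p
    using assms by (cases p) (auto simp: row_board_def cells_def)
  have short: "\<not> Suc i < length (row_board xs ys c)" for i c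
    by (simp add: row_board_def)
  have "connects 2 (row_board xs ys) p \<longleftrightarrow> (\<exists>c. c \<in> cells p \<and> Suc c \<in> cells p)" (is "?L \<longleftrightarrow> ?R") for p
  proof
    assume ?L
    then obtain c i j where "i < length (row_board xs ys c)" "row_board xs ys c ! i = p"
      "j < length (row_board xs ys (Suc c))" "row_board xs ys (Suc c) ! j = p"
      unfolding connects_two_iff using short by blast
    then show ?R using row by blast
  next
    assume ?R
    then obtain c where "c \<in> cells p" "Suc c \<in> cells p" by blast
    then show ?L
      using row[of 0 c p] row[of 0 "Suc c" p] by (intro connects_sideways[of 0 _ c 0 "Suc c"]) simp_all
  qed
  then show "connects 2 (row_board xs ys) P1 \<longleftrightarrow> adjacent_pair xs"
    "connects 2 (row_board xs ys) P2 \<longleftrightarrow> adjacent_pair ys"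
    by (auto simp: adjacent_pair_def cells_def)
qed

text \<open>The search result becomes a strategy by keeping, at P2's turns, to boards with a positive result.\<close>

lemma P1_nonlosing_of_survives:
  assumes surv: "survives n w [0] []" and "w \<ge> 2"
  shows "\<exists>s. nonlosing_strategy 2 w 1 P1 s"
proof -
  define R where "R b \<longleftrightarrow> (\<exists>n xs ys. b = row_board xs ys \<and> set xs \<inter> set ys = {} \<and>
    \<not> adjacent_pair xs \<and> \<not> adjacent_pair ys \<and> survives n w xs ys)" for b
  define I where "I ms \<longleftrightarrow> \<not> connects 2 (board_of ms) P1 \<and>
    (if to_move ms = P2 then R (board_of ms)
     else game_over 2 w 1 ms \<or>
       (\<exists>d<w. length (board_of ms d) < 1 \<and> R (drop_piece P1 d (board_of ms))))" for ms
  have R_safe: "\<not> connects 2 b P1" if "R b" for b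
    using that row_board_connects(1) unfolding R_def by blast
  have "\<exists>s. strategy_for 2 w 1 P1 s \<and>
           (\<forall>ms. legal_history 2 w 1 ms \<and> follows P1 s ms \<longrightarrow> I ms)"
  proof (rule strategy_from_invariant)
    have "drop_piece P1 0 (\<lambda>c. []) = row_board [0] []"
      by (auto simp: row_board_def drop_piece_def)
    then have "R (drop_piece P1 0 (\<lambda>c. []))"
      using surv unfolding R_def
      by (intro exI[of _ n] exI[of _ "[0]"] exI[of _ "[]"]) (simp add: adjacent_pair_def)
    moreover have "0 < w" using assms(2) by simp
    ultimately show "I []" unfolding I_def by (auto simp: connects_two_iff)
  next
    fix ms c
    assume I: "I ms" "to_move ms \<noteq> P1" "legal_move 2 w 1 ms c"
    then have P2: "to_move ms = P2" by (simp add: neq_iff_opponent)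
    then obtain n xs ys where b: "board_of ms = row_board xs ys" and disj: "set xs \<inter> set ys = {}"
      and apart: "\<not> adjacent_pair xs" "\<not> adjacent_pair ys" and surv: "survives n w xs ys"
      using I(1) unfolding I_def R_def by auto
    have c: "c < w" "c \<notin> set xs" "c \<notin> set ys"
      using I(3) by (auto simp: legal_move_def b row_board_def split: if_splits)
    have b1: "board_of (ms @ [c]) = row_board xs (c # ys)"
      using c row_board_drop(2) by (simp add: P2 b)
    have disj1: "set xs \<inter> set (c # ys) = {}" using disj c(2) by auto
    have no1: "\<not> connects 2 (board_of (ms @ [c])) P1"
      using row_board_connects(1)[OF disj1] apart(1) unfolding b1 by blast
    obtain m where "n = Suc m" using surv by (cases n) auto
    with surv c consider "adjacent_pair (c # ys)"
      | "\<forall>d<w. d \<in> set xs \<or> d \<in> set (c # ys)"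
      | d where "d < w" "d \<notin> set xs" "d \<notin> set (c # ys)" "\<not> adjacent_pair (d # xs)"
          "\<not> adjacent_pair (c # ys)" "survives m w (d # xs) (c # ys)"
      by force
    then have "game_over 2 w 1 (ms @ [c]) \<or> (\<exists>d<w. length (board_of (ms @ [c]) d) < 1 \<and>
        R (drop_piece P1 d (board_of (ms @ [c]))))"
    proof cases
      case 1
      then have "connects 2 (board_of (ms @ [c])) P2"
        using row_board_connects(2)[OF disj1] unfolding b1 by blast
      then show ?thesis unfolding game_over_def by blast
    next
      case 2
      then have "full w 1 (board_of (ms @ [c]))"
        unfolding b1 full_def row_board_def by auto
      then show ?thesis unfolding game_over_def by blast
    next
      case 3
      then have "R (row_board (d # xs) (c # ys))"
        unfolding R_def using disj1 by (intro exI[of _ m] exI[of _ "d # xs"] exI[of _ "c # ys"]) auto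
      moreover have "length (row_board xs (c # ys) d) < 1"
        using 3 by (simp add: row_board_def)
      ultimately show ?thesis
        unfolding b1 using row_board_drop(1)[OF 3(2,3)] 3(1) by auto
    qed
    with no1 show "I (ms @ [c])" unfolding I_def by (simp add: P2)
  next
    fix ms
    assume I: "I ms" "to_move ms = P1" "\<not> game_over 2 w 1 ms"
    then obtain d where "d < w" "length (board_of ms d) < 1" "R (drop_piece P1 d (board_of ms))"
      unfolding I_def by auto
    moreover from this have "I (ms @ [d])"
      using R_safe I(2) unfolding I_def by simp
    ultimately show "\<exists>c. legal_move 2 w 1 ms c \<and> I (ms @ [c])"
      using I(3) unfolding legal_move_def by blast
  qed
  then show ?thesis
    unfolding nonlosing_strategy_def complete_play_def loses_def I_def by blast
qed

lemma single_row_optimal_draw: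
  assumes "w \<in> {2, 4, 6}"
  shows "optimal_draw 2 w 1"
proof -
  obtain n where "survives n w [0] []"
    using assms survives_2 survives_4 survives_6 by blast
  moreover have "w \<ge> 2" using assms by auto
  ultimately have "\<exists>s. nonlosing_strategy 2 w 1 p s" for p
    using P1_nonlosing_of_survives odd_height_P2_nonlosing[of 1 w] by (cases p) auto
  then show ?thesis unfolding optimal_draw_def by blast
qed

theorem theorem4:
  fixes w h :: nat
  assumes "h \<ge> 1" and "w \<ge> 1"
  shows "(h = 1 \<and> w \<in> {1, 2, 4, 6} \<longrightarrow> optimal_draw 2 w h) \<and>
    (h = 1 \<and> w \<notin> {1, 2, 4, 6} \<longrightarrow> optimal_win 2 w h P2) \<and>
    (h > 1 \<and> w = 1 \<longrightarrow>
       optimal_draw 2 w h \<and> (\<forall>ms. complete_play 2 w h ms \<longrightarrow> drawn 2 w h ms)) \<and>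
    (h > 1 \<and> w > 1 \<longrightarrow> optimal_win 2 w h P2)"
proof (intro conjI impI)
  assume "h = 1 \<and> w \<in> {1, 2, 4, 6}"
  then show "optimal_draw 2 w h"
    using single_column_optimal_draw single_row_optimal_draw[of w] by auto
next
  assume h: "h = 1 \<and> w \<notin> {1, 2, 4, 6}"
  show "optimal_win 2 w h P2"
  proof (cases "odd w")
    case True
    then show ?thesis using odd_height_P2_win[of h w] h assms by auto
  next
    case False
    then have "w \<ge> 8" using h assms(2) by simp presburger
    with False even_single_row_P2_win[of w] h show ?thesis by simp
  qed
next
  assume "h > 1 \<and> w = 1"
  then show "optimal_draw 2 w h" using single_column_optimal_draw by simp
next
  assume "h > 1 \<and> w = 1"
  then show "\<forall>ms. complete_play 2 w h ms \<longrightarrow> drawn 2 w h ms"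
    using single_column_drawn by blast
next
  assume "h > 1 \<and> w > 1"
  then show "optimal_win 2 w h P2"
    using even_height_P2_win[of h w] odd_height_P2_win[of h w] by (cases "even h") auto
qed

end
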